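(* Let $c>0$, $\alpha\in[0,2\pi]$ and $a(t)=ct(\cos\alpha,\sin\alpha)\in\mathbb R^2$ for $t\in[t_{\min},t_{\max}]$. (i) If $c\le2$, the direction $\hat x=(\cos\theta,\sin\theta)$ is observable if $\theta\in[\alpha-\pi/2,\alpha+\pi/2]$. (ii) If $c>2$, the direction $\hat x=(\cos\theta,\sin\theta)$ is observable if $\theta\in[\alpha-\pi/2,\alpha+\pi/2]\cup[\alpha+\arccos(-2/c),\ \alpha+2\pi-\arccos(-2/c)]$.
   Context: Let $0<t_{\min}<t_{\max}$ and $T=t_{\max}-t_{\min}$. For an orbit function $a\in C^1([t_{\min},t_{\max}];\mathbb R^2)$ and a unit vector $\hat x\in\mathbb S^1$, put $h(t)=\hat x\cdot a(t)+t$, $\xi_{\min}^{(\hat x)}=\inf_{[t_{\min},t_{\max}]}h$, $\xi_{\max}^{(\hat x)}=\sup_{[t_{\min},t_{\max}]}h$. The direction $\hat x$ is called observable if $\xi_{\max}^{(\hat x)}-\xi_{\min}^{(\hat x)}\ge T$ (and non-observable otherwise). *)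

theory Defs
  imports "HOL-Analysis.Analysis"
begin

text \<open>
  An orbit on \<open>[t\<^sub>m\<^sub>i\<^sub>n, t\<^sub>m\<^sub>a\<^sub>x]\<close> is modelled by a total function \<open>a :: real \<Rightarrow> real ^ 2\<close> of which
  only the values on that interval matter. The \<open>Inf\<close> and \<open>Sup\<close> below are those of the
  conditionally complete lattice of the reals: they are the mathematical infimum and supremum
  whenever \<open>a\<close> is continuous on a nonempty \<open>[t\<^sub>m\<^sub>i\<^sub>n, t\<^sub>m\<^sub>a\<^sub>x]\<close>, in particular for every \<open>C\<^sup>1\<close> orbit.
  The direction \<open>x\<close> is meant to be a unit vector.
\<close>

definition phase :: "(real \<Rightarrow> real ^ 2) \<Rightarrow> real ^ 2 \<Rightarrow> real \<Rightarrow> real" where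
  "phase a x t = x \<bullet> a t + t"

definition xi_min :: "real \<Rightarrow> real \<Rightarrow> (real \<Rightarrow> real ^ 2) \<Rightarrow> real ^ 2 \<Rightarrow> real" where
  "xi_min tmin tmax a x = (INF t\<in>{tmin..tmax}. phase a x t)"

definition xi_max :: "real \<Rightarrow> real \<Rightarrow> (real \<Rightarrow> real ^ 2) \<Rightarrow> real ^ 2 \<Rightarrow> real" where
  "xi_max tmin tmax a x = (SUP t\<in>{tmin..tmax}. phase a x t)"

definition observable :: "real \<Rightarrow> real \<Rightarrow> (real \<Rightarrow> real ^ 2) \<Rightarrow> real ^ 2 \<Rightarrow> bool" where
  "observable tmin tmax a x \<longleftrightarrow> xi_max tmin tmax a x - xi_min tmin tmax a x \<ge> tmax - tmin"

end

theory Submission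
  imports Defs
begin

text \<open>Along a ray traversed at constant speed the phase is linear: with x = (cos \<theta>, sin
  \<theta>) the cosine subtraction formula gives h(t) = k t, where k = 1 + c cos(\<theta> -
  \<alpha>) (\<open>phase_ray\<close>). Its values at the two endpoints differ by |k| T, so |k|
  \<ge> 1 forces observability (\<open>observable_if_phase_linear\<close>). There are two ways to
  get |k| \<ge> 1. Either k \<ge> 1, that is cos(\<theta> - \<alpha>) \<ge> 0, which is the half
  circle facing the motion; or k \<le> -1, that is cos(\<theta> - \<alpha>) \<le> -2/c, which for c
  > 2 is an arc centred at the direction opposite to the motion
  (\<open>cos_le_if_between_arccos\<close>).\<close>

lemma observable_if_phase_linear:
  assumes "tmin \<le> tmax" and lin: "\<And>t. t \<in> {tmin..tmax} \<Longrightarrow> phase a x t = k * t" and "1 \<le> \<bar>k\<bar>"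
  shows "observable tmin tmax a x"
proof -
  let ?S = "phase a x ` {tmin..tmax}"
  \<comment> \<open>\<open>Inf\<close> and \<open>Sup\<close> on the reals bound a set only if it is
    bounded; here boundedness comes from compactness of the image of the interval.\<close>
  have "?S = (\<lambda>t. k * t) ` {tmin..tmax}"
    using lin by (intro image_cong) auto
  moreover have "compact ((\<lambda>t. k * t) ` {tmin..tmax})"
    by (intro compact_continuous_image continuous_intros) auto
  ultimately have "bounded ?S"
    by (simp add: compact_imp_bounded)
  then have bdd: "bdd_above ?S" "bdd_below ?S"
    by (auto intro: bounded_imp_bdd_above bounded_imp_bdd_below)
  have bounds: "xi_min tmin tmax a x \<le> k * t" "k * t \<le> xi_max tmin tmax a x"
    if "t \<in> {tmin..tmax}" for t
    using cINF_lower[OF bdd(2) that] cSUP_upper[OF that bdd(1)] lin[OF that]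
    by (simp_all add: xi_min_def xi_max_def)
  have "tmax - tmin \<le> \<bar>k\<bar> * (tmax - tmin)"
    using assms(1,3) mult_right_mono[of 1 "\<bar>k\<bar>" "tmax - tmin"] by simp
  also have "\<dots> = \<bar>k * tmax - k * tmin\<bar>"
    using assms(1) by (simp add: abs_mult flip: right_diff_distrib)
  \<comment> \<open>The absolute value treats both signs of \<open>k\<close> at once: for negative
    \<open>k\<close> the endpoints exchange roles.\<close>
  also have "\<dots> \<le> xi_max tmin tmax a x - xi_min tmin tmax a x"
    using bounds[of tmin] bounds[of tmax] assms(1) by auto
  finally show ?thesis
    by (simp add: observable_def)
qed

lemma phase_ray:
  assumes "a t = (c * t) *\<^sub>R vector [cos \<alpha>, sin \<alpha>]"
  shows "phase a (vector [cos \<theta>, sin \<theta>]) t = (1 + c * cos (\<theta> - \<alpha>)) * t"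
  by (simp add: phase_def assms inner_vec_def sum_2 cos_diff algebra_simps)

text \<open>Cosine decreases on [0, pi], which settles the left half of the arc; the reflection of
  \<phi> to 2 pi - \<phi> preserves the cosine and carries the right half to the left one.\<close>

lemma cos_le_if_between_arccos:
  assumes "\<bar>y\<bar> \<le> 1" and "arccos y \<le> \<phi>" and "\<phi> \<le> 2 * pi - arccos y"
  shows "cos \<phi> \<le> y"
proof -
  have bounds: "0 \<le> arccos y" and cosy: "cos (arccos y) = y"
    using assms(1) by (auto intro: arccos_lbound simp: cos_arccos_abs)
  show ?thesis
  proof (cases "\<phi> \<le> pi")
    case True
    with assms(2) bounds show ?thesis
      using cos_monotone_0_pi_le[of "arccos y" \<phi>] cosy by simp
  next
    case False
    have "cos \<phi> = cos (2 * pi - \<phi>)"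
      by (simp add: cos_diff)
    with False assms(3) bounds show ?thesis
      using cos_monotone_0_pi_le[of "arccos y" "2 * pi - \<phi>"] cosy by simp
  qed
qed

theorem lemma3p7:
  fixes tmin tmax c \<alpha> :: real and a :: "real \<Rightarrow> real ^ 2"
  assumes "0 < tmin" and "tmin < tmax"
    and "c > 0" and "\<alpha> \<in> {0..2 * pi}"
    and "\<And>t. t \<in> {tmin..tmax} \<Longrightarrow> a t = (c * t) *\<^sub>R vector [cos \<alpha>, sin \<alpha>]"
  shows "(c \<le> 2 \<longrightarrow>
            (\<forall>\<theta>\<in>{\<alpha> - pi / 2..\<alpha> + pi / 2}. observable tmin tmax a (vector [cos \<theta>, sin \<theta>]))) \<and>
         (c > 2 \<longrightarrow>
            (\<forall>\<theta>\<in>{\<alpha> - pi / 2..\<alpha> + pi / 2} \<union>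
                 {\<alpha> + arccos (- 2 / c)..\<alpha> + 2 * pi - arccos (- 2 / c)}.
               observable tmin tmax a (vector [cos \<theta>, sin \<theta>])))"
proof -
  have obs: "observable tmin tmax a (vector [cos \<theta>, sin \<theta>])"
    if "1 \<le> \<bar>1 + c * cos (\<theta> - \<alpha>)\<bar>" for \<theta>
  proof (rule observable_if_phase_linear[OF _ _ that])
    show "phase a (vector [cos \<theta>, sin \<theta>]) t = (1 + c * cos (\<theta> - \<alpha>)) * t"
      if "t \<in> {tmin..tmax}" for t
      by (rule phase_ray) (rule assms(5)[OF that])
  qed (use assms(2) in simp)
  have forward: "observable tmin tmax a (vector [cos \<theta>, sin \<theta>])"
    if "\<theta> \<in> {\<alpha> - pi / 2..\<alpha> + pi / 2}" for \<theta>
  proof (rule obs)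
    have "0 \<le> cos (\<theta> - \<alpha>)"
      using that by (intro cos_ge_zero) auto
    then show "1 \<le> \<bar>1 + c * cos (\<theta> - \<alpha>)\<bar>"
      using assms(3) by simp
  qed
  have backward: "observable tmin tmax a (vector [cos \<theta>, sin \<theta>])"
    if "2 < c" and "\<theta> \<in> {\<alpha> + arccos (- 2 / c)..\<alpha> + 2 * pi - arccos (- 2 / c)}" for \<theta>
  proof (rule obs)
    \<comment> \<open>Since c > 2, the number -2/c lies in [-1, 1], where \<open>arccos\<close>
      really inverts the cosine.\<close>
    have "cos (\<theta> - \<alpha>) \<le> - 2 / c"
      using that by (intro cos_le_if_between_arccos) auto
    then have "c * cos (\<theta> - \<alpha>) \<le> - 2"
      using assms(3) by (simp add: field_simps)
    \<comment> \<open>The slope is now at most -1: the phase decreases, at rate at least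
      one.\<close>
    then show "1 \<le> \<bar>1 + c * cos (\<theta> - \<alpha>)\<bar>"
      by simp
  qed
  show ?thesis
    using forward backward by blast
qed

end
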